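(* For every integer $n\ge1$, $$P''_{100}(n)=\sum_{j,k\ge0}q^{j^2+k^2+j}{2n-k-1\brack j}_{q^2}{j\brack k}_{q^2},$$ and $P''_{100}(n)$ is a palindromic polynomial in $q$.
   Context: A skew double shifted plane partition (DSPP) with profile $100$ is a 4-tuple of integer partitions $a=(a_1,a_2,\dots)$, $b=(b_1,b_2,\dots)$, $c=(c_1,c_2,\dots)$, $d=(d_1,d_2,\dots)$ (weakly decreasing, padded by zeros) such that $b_1\ge a_1\ge b_2\ge a_2\ge\cdots$, $b_1\ge c_1\ge b_2\ge c_2\ge\cdots$ and $c_1\ge d_1\ge c_2\ge d_2\ge\cdots$. Its size $|\Lambda|$ is the sum of all the entries $a_i,b_i,c_i,d_i$. For $n\ge1$ let $\mathrm{DSPP}''_{100}(n)$ be the set of DSPPs with profile $100$ satisfying $a_{n+1}=b_{n+2}=c_{n+1}=d_n=0$, let $F''_{100}(n)=\sum_{\Lambda\in\mathrm{DSPP}''_{100}(n)}q^{|\Lambda|}$, and let $P''_{100}(n)=(q;q)_{4n}F''_{100}(n)$. A polynomial $p(x)$ is palindromic if $p(x)=x^{\deg p}\,p(x^{-1})$. Here $(a;q)_0=1$, $(a;q)_n=\prod_{i=0}^{n-1}(1-aq^i)$, and ${n\brack m}_q=\frac{(q;q)_n}{(q;q)_m(q;q)_{n-m}}$ if $n\ge m\ge0$ and $0$ otherwise; ${n\brack m}_{q^2}$ is the same with $q\to q^2$. *)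

theory Defs
  imports "HOL-Analysis.Infinite_Sum" "HOL-Computational_Algebra.Polynomial_FPS"
begin

definition qpoch :: "'a::comm_ring_1 \<Rightarrow> 'a \<Rightarrow> nat \<Rightarrow> 'a" where
  "qpoch a q n = (\<Prod>i<n. 1 - a * q ^ i)"

text \<open>Both arguments are integers, so that an upper index such as \<open>2n - k - 1\<close> may be negative.
  The base \<open>q\<close> is a formal power series with zero constant term (\<open>fps_X\<close> or \<open>fps_X\<^sup>2\<close>
  in the sequel), hence the denominator is invertible and the division is exact.\<close>

definition qbinom :: "rat fps \<Rightarrow> int \<Rightarrow> int \<Rightarrow> rat fps" where
  "qbinom q n m =
     (if 0 \<le> m \<and> m \<le> n
      then qpoch q q (nat n) / (qpoch q q (nat m) * qpoch q q (nat (n - m)))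
      else 0)"

text \<open>A partition is stored as a sequence indexed from \<open>0\<close>:
  \<open>p i\<close> is the part written \<open>p\<^sub>i\<^sub>+\<^sub>1\<close> in the usual numbering.\<close>

definition is_partition :: "(nat \<Rightarrow> nat) \<Rightarrow> bool" where
  "is_partition p \<longleftrightarrow> antimono p \<and> finite {i. p i \<noteq> 0}"

definition partition_size :: "(nat \<Rightarrow> nat) \<Rightarrow> nat" where
  "partition_size p = (\<Sum>i | p i \<noteq> 0. p i)"

text \<open>\<open>x\<^sub>1 \<ge> y\<^sub>1 \<ge> x\<^sub>2 \<ge> y\<^sub>2 \<ge> \<dots>\<close>\<close>

definition interlaces :: "(nat \<Rightarrow> nat) \<Rightarrow> (nat \<Rightarrow> nat) \<Rightarrow> bool" where
  "interlaces x y \<longleftrightarrow> (\<forall>i. x i \<ge> y i \<and> y i \<ge> x (Suc i))"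

type_synonym partition4 = "(nat \<Rightarrow> nat) \<times> (nat \<Rightarrow> nat) \<times> (nat \<Rightarrow> nat) \<times> (nat \<Rightarrow> nat)"

definition DSPP100 :: "partition4 set" where
  "DSPP100 = {(a, b, c, d).
     is_partition a \<and> is_partition b \<and> is_partition c \<and> is_partition d \<and>
     interlaces b a \<and> interlaces b c \<and> interlaces c d}"

fun DSPP_size :: "partition4 \<Rightarrow> nat" where
  "DSPP_size (a, b, c, d) =
     partition_size a + partition_size b + partition_size c + partition_size d"

text \<open>For \<open>n \<ge> 1\<close>: the conditions \<open>a\<^sub>n\<^sub>+\<^sub>1 = b\<^sub>n\<^sub>+\<^sub>2 = c\<^sub>n\<^sub>+\<^sub>1 = d\<^sub>n = 0\<close>, shifted to indices from \<open>0\<close>.\<close>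

definition DSPP100'' :: "nat \<Rightarrow> partition4 set" where
  "DSPP100'' n = {(a, b, c, d) \<in> DSPP100.
     a n = 0 \<and> b (n + 1) = 0 \<and> c n = 0 \<and> d (n - 1) = 0}"

definition F100'' :: "nat \<Rightarrow> rat fps" where
  "F100'' n = Abs_fps (\<lambda>m. of_nat (card {\<Lambda> \<in> DSPP100'' n. DSPP_size \<Lambda> = m}))"

definition P100'' :: "nat \<Rightarrow> rat fps" where
  "P100'' n = qpoch fps_X fps_X (4 * n) * F100'' n"

definition palindromic :: "rat poly \<Rightarrow> bool" where
  "palindromic p \<longleftrightarrow> (\<forall>x. x \<noteq> 0 \<longrightarrow> poly p x = x ^ degree p * poly p (inverse x))"

end

theory Submission imports Defs begin

text \<open>Put \<open>M = 2n - 1\<close>. The entries of a plane partition in question label a poset of width two: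
  a chain \<open>Y\<^sub>0 > Y\<^sub>1 > \<dots> > Y\<^sub>M\<^sub>+\<^sub>1\<close>, which carries \<open>b\<^sub>1, c\<^sub>1, b\<^sub>2, c\<^sub>2, \<dots>, b\<^sub>n\<^sub>+\<^sub>1\<close>, and elements
  \<open>X\<^sub>1, \<dots>, X\<^sub>M\<close>, which carry \<open>a\<^sub>1, d\<^sub>1, a\<^sub>2, d\<^sub>2, \<dots>, a\<^sub>n\<close>, where \<open>X\<^sub>i\<close> lies between \<open>Y\<^sub>i\<^sub>-\<^sub>1\<close> and
  \<open>Y\<^sub>i\<^sub>+\<^sub>1\<close> and consecutive \<open>X\<^sub>i, X\<^sub>i\<^sub>+\<^sub>1\<close> are incomparable. In this form the parity of \<open>M\<close> no longer
  matters, and one can recurse on \<open>M\<close> in steps of one.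

  For a finite poset \<open>V\<close> let \<open>p V\<close> be \<open>(q;q)\<^sub>|\<^sub>V\<^sub>|\<close> times the generating function of the
  order-preserving labellings of \<open>V\<close>. If \<open>v\<close> is the least element, subtracting its label from all labels
  gives \<open>p V = p (V - {v})\<close>. If \<open>v\<close> and \<open>w\<close> are two minimal elements and \<open>v\<close> lies below everything
  else, then either the label of \<open>v\<close> is a minimum, or that of \<open>w\<close> is smaller than all others; hence
  \<open>p V = p (V - {v}) + q\<^bsup>|V| - 1\<^esup> p (V - {w})\<close> (\<open>numerator_remove_minimal\<close>). Peeling the bottom of the
  ladder in this way yields (\<open>numerator_ladder_rec\<close>)
  \[P_M = (1 + q^{2M}) P_{M-1} + q^{2M-1} P_{M-2}, \qquad P_0 = 1,\; P_1 = 1 + q^2.\]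

  The double sum satisfies the same recurrence (\<open>sum_summand_rec\<close>): apply one Pascal rule to the first
  Gaussian binomial and the other one to the second, shifting \<open>j\<close> and then \<open>k\<close> by one. The recurrence
  also gives palindromicity: by induction \<open>P\<^sub>M\<close> has degree \<open>M (M + 1)\<close>, and both summands on the
  right-hand side are symmetric about \<open>M (M + 1) / 2\<close>.\<close>

section \<open>Labellings of a finite poset\<close>

definition labellings :: "('v \<Rightarrow> 'v \<Rightarrow> bool) \<Rightarrow> 'v set \<Rightarrow> ('v \<Rightarrow> nat) set" where
  "labellings r V = {f. (\<forall>u. u \<notin> V \<longrightarrow> f u = 0) \<and> (\<forall>u\<in>V. \<forall>v\<in>V. r u v \<longrightarrow> f v \<le> f u)}"

text \<open>The set \<open>V\<close> is a separate argument because the labellings of a subposet, which vanish outside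
  it, are also counted as labellings of a larger poset.\<close>

definition sum_gf :: "'v set \<Rightarrow> ('v \<Rightarrow> nat) set \<Rightarrow> rat fps" where
  "sum_gf V A = Abs_fps (\<lambda>m. of_nat (card {f \<in> A. sum f V = m}))"

text \<open>By Stanley's theory of \<open>P\<close>-partitions this is the generating polynomial of the linear extensions
  of \<open>V\<close> by major index. Normalising by \<open>(q;q)\<^sub>|\<^sub>V\<^sub>|\<close> removes the denominators from the recurrences
  below.\<close>

definition numerator :: "('v \<Rightarrow> 'v \<Rightarrow> bool) \<Rightarrow> 'v set \<Rightarrow> rat fps" where
  "numerator r V = qpoch fps_X fps_X (card V) * sum_gf V (labellings r V)"

definition raise :: "nat \<Rightarrow> 'v set \<Rightarrow> ('v \<Rightarrow> nat) \<Rightarrow> ('v \<Rightarrow> nat)" where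
  "raise e W f = (\<lambda>u. f u + e * of_bool (u \<in> W))"

lemma qpoch_Suc: "qpoch a q (Suc n) = qpoch a q n * (1 - a * q ^ n)"
  by (simp add: qpoch_def)

lemma finite_supported_sum_eq:
  fixes V :: "'v set"
  assumes "finite V"
  shows "finite {f :: 'v \<Rightarrow> nat. (\<forall>u. u \<notin> V \<longrightarrow> f u = 0) \<and> sum f V = m}"
proof (rule finite_subset)
  show "{f :: 'v \<Rightarrow> nat. (\<forall>u. u \<notin> V \<longrightarrow> f u = 0) \<and> sum f V = m}
        \<subseteq> {f. \<forall>u. (u \<in> V \<longrightarrow> f u \<in> {..m}) \<and> (u \<notin> V \<longrightarrow> f u = 0)}"
    using assms by (auto intro: member_le_sum)
  show "finite {f :: 'v \<Rightarrow> nat. \<forall>u. (u \<in> V \<longrightarrow> f u \<in> {..m}) \<and> (u \<notin> V \<longrightarrow> f u = 0)}"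
    by (rule finite_set_of_finite_funs) (use assms in auto)
qed

lemma sum_gf_disjoint_union:
  assumes "finite V" and "\<And>f u. f \<in> A \<union> B \<Longrightarrow> u \<notin> V \<Longrightarrow> f u = 0" and "A \<inter> B = {}"
  shows "sum_gf V (A \<union> B) = sum_gf V A + sum_gf V B"
proof (rule fps_ext)
  fix m
  have fin: "finite {f \<in> C. sum f V = m}" if "C \<subseteq> A \<union> B" for C
    by (rule finite_subset[OF _ finite_supported_sum_eq[OF assms(1), of m]]) (use that assms(2) in blast)
  have "{f \<in> A \<union> B. sum f V = m} = {f \<in> A. sum f V = m} \<union> {f \<in> B. sum f V = m}" by auto
  then have "card {f \<in> A \<union> B. sum f V = m} = card {f \<in> A. sum f V = m} + card {f \<in> B. sum f V = m}"
    using assms(3) by (simp add: card_Un_disjoint fin disjoint_iff)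
  then show "fps_nth (sum_gf V (A \<union> B)) m = fps_nth (sum_gf V A + sum_gf V B) m"
    by (simp add: sum_gf_def)
qed

lemma sum_raise:
  assumes "finite V" "W \<subseteq> V"
  shows "sum (raise e W f) V = sum f V + e * card W"
proof -
  have "sum (raise e W f) V = sum f V + e * (\<Sum>u\<in>V. of_bool (u \<in> W))"
    by (simp add: raise_def sum.distrib sum_distrib_left)
  also have "(\<Sum>u\<in>V. of_bool (u \<in> W)) = card W"
    using assms by (simp add: sum.If_cases of_bool_def Int_absorb1 Int_commute)
  finally show ?thesis .
qed

lemma inj_raise: "inj (raise e W)"
  by (rule injI) (auto simp: raise_def fun_eq_iff)

lemma sum_gf_raise:
  assumes "finite V" "W \<subseteq> V"
  shows "sum_gf V (raise e W ` A) = fps_X ^ (e * card W) * sum_gf V A"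
proof (rule fps_ext)
  fix m
  let ?k = "e * card W"
  have eq: "{f \<in> raise e W ` A. sum f V = m} = raise e W ` {f \<in> A. sum f V + ?k = m}"
    by (auto simp: sum_raise[OF assms])
  have "card {f \<in> raise e W ` A. sum f V = m} = card {f \<in> A. sum f V + ?k = m}"
    unfolding eq by (rule card_image) (rule inj_on_subset[OF inj_raise], simp)
  also have "\<dots> = (if m < ?k then 0 else card {f \<in> A. sum f V = m - ?k})"
    by (auto intro!: arg_cong[where f = card])
  finally show "fps_nth (sum_gf V (raise e W ` A)) m = fps_nth (fps_X ^ ?k * sum_gf V A) m"
    by (simp add: sum_gf_def fps_X_power_mult_nth)
qed

lemma sum_gf_remove_zero:
  assumes "finite V" "\<And>f. f \<in> A \<Longrightarrow> f v = 0"
  shows "sum_gf V A = sum_gf (V - {v}) A"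
proof -
  have "sum f V = sum f (V - {v})" if "f \<in> A" for f
    using assms(1) assms(2)[OF that] by (intro sum.mono_neutral_right) auto
  then have "{f \<in> A. sum f V = m} = {f \<in> A. sum f (V - {v}) = m}" for m
    by auto
  then show ?thesis by (simp add: sum_gf_def)
qed

lemma raise_lower:
  assumes "\<And>u. u \<in> W \<Longrightarrow> e \<le> f u"
  shows "raise e W (\<lambda>u. f u - e * of_bool (u \<in> W)) = f"
  using assms by (auto simp: raise_def fun_eq_iff)

text \<open>Both cases of the recurrence come from here: \<open>e = 0\<close> expresses that the label of \<open>v\<close> is a
  minimum, and \<open>e = 1\<close> that it is smaller than all other labels. Lowering all labels by one as often as
  possible leaves a labelling with \<open>f v = 0\<close>, so the generating function is \<open>1 / (1 - q\<^bsup>|V|\<^esup>)\<close> times that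
  of \<open>Z\<close>; and such a labelling is one of \<open>V - {v}\<close> with all labels raised by \<open>e\<close>.
  Minimality of \<open>v\<close> is what makes the label \<open>0\<close> at \<open>v\<close> compatible with \<open>r\<close>.\<close>

lemma sum_gf_labellings_least:
  fixes r :: "'v \<Rightarrow> 'v \<Rightarrow> bool" and e :: nat
  assumes V: "finite V" "v \<in> V"
    and minimal: "\<And>u. u \<in> V \<Longrightarrow> \<not> r v u"
  defines "A \<equiv> {f \<in> labellings r V. \<forall>u\<in>V - {v}. f v + e \<le> f u}"
  shows "(1 - fps_X ^ card V) * sum_gf V A
         = fps_X ^ (e * (card V - 1)) * sum_gf (V - {v}) (labellings r (V - {v}))"
proof -
  let ?W = "V - {v}"
  define Z where "Z = {f \<in> A. f v = 0}"
  have supp: "f u = 0" if "f \<in> A" "u \<notin> V" for f u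
    using that by (simp add: A_def labellings_def)
  have split: "A = Z \<union> raise 1 V ` A"
  proof (intro equalityI subsetI)
    fix f assume f: "f \<in> A"
    show "f \<in> Z \<union> raise 1 V ` A"
    proof (cases "f v = 0")
      case True
      with f show ?thesis by (simp add: Z_def)
    next
      case False
      have le: "f v + e \<le> f u" if "u \<in> ?W" for u
        using f that by (simp add: A_def)
      have pos: "1 \<le> f u" if "u \<in> V" for u
        using False le[of u] that by (cases "u = v") auto
      have "f v - 1 + e \<le> f u - 1" if "u \<in> ?W" for u
        using False le[OF that] by linarith
      then have "(\<lambda>u. f u - 1 * of_bool (u \<in> V)) \<in> A"
        using f V by (auto simp: A_def labellings_def intro!: diff_le_mono)
      moreover have "f = raise 1 V (\<lambda>u. f u - 1 * of_bool (u \<in> V))"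
        by (rule raise_lower[symmetric]) (rule pos)
      ultimately have "f \<in> raise 1 V ` A" by (rule rev_image_eqI[where f = "raise 1 V"])
      then show ?thesis ..
    qed
  next
    fix f assume "f \<in> Z \<union> raise 1 V ` A"
    then show "f \<in> A"
      using V by (auto simp: Z_def A_def labellings_def raise_def)
  qed
  have "sum_gf V A = sum_gf V (Z \<union> raise 1 V ` A)"
    by (rule arg_cong[OF split])
  also have "\<dots> = sum_gf V Z + sum_gf V (raise 1 V ` A)"
  proof (rule sum_gf_disjoint_union)
    show "finite V" by fact
    show "f u = 0" if "f \<in> Z \<union> raise 1 V ` A" "u \<notin> V" for f u
      using that unfolding split[symmetric] by (rule supp)
    show "Z \<inter> raise 1 V ` A = {}"
      using V by (auto simp: Z_def raise_def)
  qed
  finally have "(1 - fps_X ^ card V) * sum_gf V A = sum_gf V Z"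
    using V by (simp add: sum_gf_raise algebra_simps)
  also have "Z = raise e ?W ` labellings r ?W"
  proof (intro equalityI subsetI)
    fix f assume f: "f \<in> Z"
    have "(\<lambda>u. f u - e * of_bool (u \<in> ?W)) \<in> labellings r ?W"
      using f by (auto simp: Z_def A_def labellings_def intro!: diff_le_mono)
    moreover have "f = raise e ?W (\<lambda>u. f u - e * of_bool (u \<in> ?W))"
      by (rule raise_lower[symmetric]) (use f in \<open>auto simp: Z_def A_def\<close>)
    ultimately show "f \<in> raise e ?W ` labellings r ?W" by (rule rev_image_eqI[where f = "raise e ?W"])
  next
    fix f assume "f \<in> raise e ?W ` labellings r ?W"
    then obtain g where g: "g \<in> labellings r ?W" and f: "f = raise e ?W g" ..
    have supp_f: "f u = 0" if "u \<notin> ?W" for u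
      using g that by (auto simp: f raise_def labellings_def)
    have "f w \<le> f u" if "u \<in> V" "w \<in> V" "r u w" for u w
    proof (cases "w = v")
      case True
      then show ?thesis using supp_f by simp
    next
      case False
      with that minimal have "u \<in> ?W" "w \<in> ?W" by auto
      with g that(3) show ?thesis by (auto simp: f raise_def labellings_def)
    qed
    moreover have "e \<le> f u" if "u \<in> ?W" for u
      using that by (simp add: f raise_def)
    ultimately show "f \<in> Z"
      using supp_f V by (simp add: Z_def A_def labellings_def)
  qed
  also have "sum_gf V (raise e ?W ` labellings r ?W)
      = fps_X ^ (e * (card V - 1)) * sum_gf V (labellings r ?W)"
    using V by (subst sum_gf_raise) auto
  also have "sum_gf V (labellings r ?W) = sum_gf ?W (labellings r ?W)"
    by (rule sum_gf_remove_zero) (use V in \<open>auto simp: labellings_def\<close>)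
  finally show ?thesis .
qed

lemma numerator_remove_bottom:
  assumes "finite V" "v \<in> V" "\<And>u. u \<in> V \<Longrightarrow> \<not> r v u"
    and "\<And>u. u \<in> V - {v} \<Longrightarrow> r u v"
  shows "numerator r V = numerator r (V - {v})"
proof -
  have "{f \<in> labellings r V. \<forall>u\<in>V - {v}. f v + 0 \<le> f u} = labellings r V"
    using assms(2,4) by (auto simp: labellings_def)
  with sum_gf_labellings_least[of V v r 0] assms(1-3)
  have *: "(1 - fps_X ^ card V) * sum_gf V (labellings r V)
        = sum_gf (V - {v}) (labellings r (V - {v}))" by simp
  obtain N where N: "card V = Suc N" "card (V - {v}) = N"
    using assms(1,2) by (metis card_Suc_Diff1)
  show ?thesis
    unfolding numerator_def *[symmetric] N by (simp add: qpoch_Suc)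
qed

text \<open>A labelling either satisfies \<open>f v \<le> f w\<close>, and then \<open>v\<close> carries a minimal label, or it satisfies
  \<open>f w < f v\<close>, and then \<open>w\<close> carries the only minimal label, since every other element lies above
  \<open>v\<close>. Both parts are given by \<open>sum_gf_labellings_least\<close>.\<close>

lemma numerator_remove_minimal:
  assumes "finite V" "v \<in> V" "w \<in> V" "v \<noteq> w"
    and "\<And>u. u \<in> V \<Longrightarrow> \<not> r v u" "\<And>u. u \<in> V \<Longrightarrow> \<not> r w u"
    and "\<And>u. u \<in> V - {v, w} \<Longrightarrow> r u v"
  shows "numerator r V = numerator r (V - {v}) + fps_X ^ (card V - 1) * numerator r (V - {w})"
proof -
  define A where "A = {f \<in> labellings r V. \<forall>u\<in>V - {v}. f v + 0 \<le> f u}"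
  define B where "B = {f \<in> labellings r V. \<forall>u\<in>V - {w}. f w + 1 \<le> f u}"
  have below: "f v \<le> f u" if "f \<in> labellings r V" "u \<in> V - {v, w}" for f u
    using that assms by (auto simp: labellings_def)
  have "labellings r V \<subseteq> A \<union> B"
  proof
    fix f assume f: "f \<in> labellings r V"
    show "f \<in> A \<union> B"
    proof (cases "f v \<le> f w")
      case True
      with f below have "f \<in> A" by (fastforce simp: A_def)
      then show ?thesis ..
    next
      case False
      have "f w + 1 \<le> f u" if "u \<in> V - {w}" for u
        using False below[OF f, of u] that by (cases "u = v") auto
      with f have "f \<in> B" by (simp add: B_def)
      then show ?thesis ..
    qed
  qed
  then have AB: "labellings r V = A \<union> B" by (auto simp: A_def B_def)
  have disj: "A \<inter> B = {}"
    using assms by (force simp: A_def B_def)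
  have "sum_gf V (labellings r V) = sum_gf V A + sum_gf V B"
    unfolding AB
    by (rule sum_gf_disjoint_union) (use assms disj in \<open>auto simp: A_def B_def labellings_def\<close>)
  then have *: "(1 - fps_X ^ card V) * sum_gf V (labellings r V)
      = sum_gf (V - {v}) (labellings r (V - {v}))
        + fps_X ^ (card V - 1) * sum_gf (V - {w}) (labellings r (V - {w}))"
    using sum_gf_labellings_least[of V v r 0] sum_gf_labellings_least[of V w r 1] assms(1-6)
    by (simp add: A_def B_def distrib_left)
  obtain N where N: "card V = Suc N" "card (V - {v}) = N" "card (V - {w}) = N"
    using assms(1-3) by (metis card_Suc_Diff1 nat.inject)
  have "numerator r V = qpoch fps_X fps_X N * ((1 - fps_X ^ card V) * sum_gf V (labellings r V))"
    unfolding numerator_def N by (simp add: qpoch_Suc mult.assoc)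
  also have "\<dots> = numerator r (V - {v}) + fps_X ^ (card V - 1) * numerator r (V - {w})"
    unfolding * unfolding numerator_def N by (simp only: distrib_left mult.left_commute diff_Suc_1)
  finally show ?thesis .
qed

section \<open>The ladder poset\<close>

datatype node = X nat | Y nat

text \<open>The order relation does not mention the size of the ladder, so that removing nodes from a
  ladder induces the order of a smaller one.\<close>

fun above :: "node \<Rightarrow> node \<Rightarrow> bool" where
  "above (Y i) (Y j) \<longleftrightarrow> i < j"
| "above (Y i) (X j) \<longleftrightarrow> i < j"
| "above (X i) (Y j) \<longleftrightarrow> i < j"
| "above (X i) (X j) \<longleftrightarrow> Suc i < j"

text \<open>\<open>X 0\<close> is left out: the node \<open>X i\<close> has to lie below \<open>Y (i - 1)\<close>.\<close>

definition ladder :: "nat \<Rightarrow> node set" where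
  "ladder M = Y ` {..Suc M} \<union> X ` {1..M}"

lemma card_nodes:
  assumes "finite I" "finite J"
  shows "card (Y ` I \<union> X ` J) = card I + card J"
proof -
  have "card (Y ` I \<union> X ` J) = card (Y ` I) + card (X ` J)"
    using assms by (intro card_Un_disjoint) auto
  also have "card (Y ` I) = card I" by (rule card_image) (simp add: inj_on_def)
  also have "card (X ` J) = card J" by (rule card_image) (simp add: inj_on_def)
  finally show ?thesis .
qed

lemma numerator_ladder_remove_bottom:
  "numerator above (ladder M) = numerator above (Y ` {..M} \<union> X ` {1..M})"
proof -
  have "ladder M - {Y (Suc M)} = Y ` {..M} \<union> X ` {1..M}"
    by (auto simp: ladder_def)
  then show ?thesis
    by (subst numerator_remove_bottom[where v = "Y (Suc M)"]) (auto simp: ladder_def)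
qed

text \<open>Once the bottom \<open>Y (M + 2)\<close> is gone, the minimal elements are \<open>Y (M + 1)\<close>, which lies below all
  other nodes but \<open>X (M + 1)\<close>, and \<open>X (M + 1)\<close> itself. Without the latter, \<open>Y (M + 1)\<close> is the bottom of a
  ladder of size \<open>M\<close>.\<close>

lemma numerator_ladder_peel:
  "numerator above (ladder (Suc M))
   = numerator above (Y ` {..M} \<union> X ` {1..Suc M}) + fps_X ^ (2 * M + 2) * numerator above (ladder M)"
proof -
  let ?V = "Y ` {..Suc M} \<union> X ` {1..Suc M}"
  have "?V - {Y (Suc M)} = Y ` {..M} \<union> X ` {1..Suc M}" "?V - {X (Suc M)} = ladder M"
    by (auto simp: ladder_def)
  moreover have "card ?V - 1 = 2 * M + 2"
    by (subst card_nodes) auto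
  ultimately show ?thesis
    unfolding numerator_ladder_remove_bottom[of "Suc M"]
    by (subst numerator_remove_minimal[where v = "Y (Suc M)" and w = "X (Suc M)"]) auto
qed

lemma numerator_ladder_0: "numerator above (ladder 0) = 1"
proof -
  have "numerator above (ladder 0) = numerator above (Y ` {..0} \<union> X ` {1..0})"
    by (rule numerator_ladder_remove_bottom)
  also have "\<dots> = numerator above (Y ` {..0} \<union> X ` {1..0} - {Y 0})"
    by (rule numerator_remove_bottom) auto
  also have "Y ` {..0} \<union> X ` {1..0} - {Y 0} = {}" by auto
  also have "numerator above {} = 1"
    by (rule fps_ext)
       (auto simp: numerator_def qpoch_def sum_gf_def labellings_def simp flip: fun_eq_iff)
  finally show ?thesis .
qed

lemma numerator_ladder_1: "numerator above (ladder (Suc 0)) = 1 + fps_X ^ 2"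
proof -
  have "Y ` {..0} \<union> X ` {1..Suc 0} - {X (Suc 0)} = Y ` {..0} \<union> X ` {1..0}"
    by auto
  then have "numerator above (Y ` {..0} \<union> X ` {1..Suc 0}) = numerator above (ladder 0)"
    unfolding numerator_ladder_remove_bottom
    by (subst numerator_remove_bottom[where v = "X (Suc 0)"]) auto
  then show ?thesis
    by (simp only: numerator_ladder_peel numerator_ladder_0 mult_0_right add_0 mult_1_right)
qed

text \<open>In the poset \<open>?R\<close> that remains after removing \<open>Y (M + 3)\<close> and \<open>Y (M + 2)\<close>, the minimal elements are
  \<open>X (M + 2)\<close>, which lies below all other nodes but \<open>X (M + 1)\<close>, and \<open>X (M + 1)\<close>. Removing the former leaves a
  ladder of size \<open>M + 1\<close> without its bottom. Removing the latter makes \<open>X (M + 2)\<close> a least element, below a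
  ladder of size \<open>M\<close>.\<close>

lemma numerator_ladder_rec:
  "numerator above (ladder (Suc (Suc M)))
   = (1 + fps_X ^ (2 * M + 4)) * numerator above (ladder (Suc M))
     + fps_X ^ (2 * M + 3) * numerator above (ladder M)"
proof -
  let ?R = "Y ` {..Suc M} \<union> X ` {1..Suc (Suc M)}"
  let ?U = "?R - {X (Suc M)}"
  have diff: "?R - {X (Suc (Suc M))} = Y ` {..Suc M} \<union> X ` {1..Suc M}"
    "?U - {X (Suc (Suc M))} = ladder M"
    by (auto simp: ladder_def)
  have "card ?R - 1 = 2 * M + 3"
    by (subst card_nodes) auto
  then have "numerator above ?R
      = numerator above (ladder (Suc M)) + fps_X ^ (2 * M + 3) * numerator above ?U"
    unfolding numerator_ladder_remove_bottom diff(1)[symmetric]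
    by (subst numerator_remove_minimal[where v = "X (Suc (Suc M))" and w = "X (Suc M)"]) auto
  moreover have "numerator above ?U = numerator above (ladder M)"
    unfolding diff(2)[symmetric]
    by (rule numerator_remove_bottom) auto
  ultimately show ?thesis
    using numerator_ladder_peel[of "Suc M"] by (simp add: distrib_right add_ac del: power_Suc)
qed


section \<open>The palindromic polynomials of the recurrence\<close>

fun ladder_poly :: "nat \<Rightarrow> rat poly" where
  "ladder_poly 0 = 1"
| "ladder_poly (Suc 0) = 1 + monom 1 2"
| "ladder_poly (Suc (Suc M)) = (1 + monom 1 (2 * M + 4)) * ladder_poly (Suc M)
     + monom 1 (2 * M + 3) * ladder_poly M"

lemma degree_one_plus_monom: "0 < k \<Longrightarrow> degree (1 + monom (1::rat) k) = k"
  by (subst degree_add_eq_right) (simp_all add: degree_monom_eq)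

lemma degree_ladder_poly: "degree (ladder_poly M) = M * (M + 1)"
proof (induction M rule: ladder_poly.induct)
  case (3 M)
  have ne: "ladder_poly (Suc M) \<noteq> 0"
    using "3.IH"(1) by auto
  have ne': "1 + monom (1::rat) (2 * M + 4) \<noteq> 0"
    using degree_one_plus_monom[of "2 * M + 4"] by auto
  have d: "degree ((1 + monom 1 (2 * M + 4)) * ladder_poly (Suc M)) = Suc (Suc M) * (Suc (Suc M) + 1)"
    by (subst degree_mult_eq[OF ne' ne]) (simp add: degree_one_plus_monom "3.IH"(1))
  have "degree (monom 1 (2 * M + 3) * ladder_poly M) \<le> 2 * M + 3 + M * (M + 1)"
    using degree_mult_le[of "monom 1 (2 * M + 3)" "ladder_poly M"] "3.IH"(2)
    by (simp add: degree_monom_eq)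
  also have "\<dots> < Suc (Suc M) * (Suc (Suc M) + 1)" by simp
  finally show ?case
    using d by (simp only: ladder_poly.simps) (subst degree_add_eq_left, simp_all)
qed (simp_all add: degree_one_plus_monom)

text \<open>Symmetry about \<open>M (M + 1) / 2\<close> passes through the recurrence because
  \<open>(M + 2) (M + 3) = (2M + 4) + (M + 1) (M + 2) = 2 (2M + 3) + M (M + 1)\<close>.\<close>

lemma poly_ladder_poly_inverse:
  "x \<noteq> 0 \<Longrightarrow> poly (ladder_poly M) x = x ^ (M * (M + 1)) * poly (ladder_poly M) (inverse x)"
proof (induction M rule: ladder_poly.induct)
  case (3 M)
  have e: "Suc (Suc M) * (Suc (Suc M) + 1) = (2 * M + 4) + Suc M * (Suc M + 1)"
    "Suc (Suc M) * (Suc (Suc M) + 1) = 2 * (2 * M + 3) + M * (M + 1)"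
    by simp_all
  have 1: "x ^ (Suc (Suc M) * (Suc (Suc M) + 1)) * ((1 + inverse x ^ (2 * M + 4)) * y)
      = (1 + x ^ (2 * M + 4)) * (x ^ (Suc M * (Suc M + 1)) * y)" for y
    unfolding e(1) power_add[of x "2 * M + 4"] using "3.prems"
    by (simp add: field_simps del: power_add)
  have 2: "x ^ (Suc (Suc M) * (Suc (Suc M) + 1)) * (inverse x ^ (2 * M + 3) * y)
      = x ^ (2 * M + 3) * (x ^ (M * (M + 1)) * y)" for y
    unfolding e(2) power_add[of x "2 * (2 * M + 3)"] power_even_eq[of x] using "3.prems"
    by (simp add: field_simps power2_eq_square)
  show ?case
    unfolding ladder_poly.simps poly_add poly_mult poly_monom poly_1 mult_1
      distrib_left[of "x ^ (Suc (Suc M) * (Suc (Suc M) + 1))"]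
      1 2 "3.IH"(1)[OF "3.prems", symmetric] "3.IH"(2)[OF "3.prems", symmetric] power_one ..
qed (simp_all add: poly_monom field_simps eval_nat_numeral)

lemma palindromic_ladder_poly: "palindromic (ladder_poly M)"
  unfolding palindromic_def degree_ladder_poly using poly_ladder_poly_inverse by blast

section \<open>Gaussian binomial coefficients\<close>

abbreviation qfact :: "rat fps \<Rightarrow> nat \<Rightarrow> rat fps" where
  "qfact q n \<equiv> qpoch q q n"

lemma qfact_nth_0: "fps_nth q 0 = 0 \<Longrightarrow> fps_nth (qfact q n) 0 = 1"
  by (induction n) (simp_all add: qpoch_Suc, simp add: qpoch_def)

lemma qbinom_mult_qfact:
  assumes "fps_nth q 0 = 0" "m \<le> n"
  shows "qbinom q (int n) (int m) * (qfact q m * qfact q (n - m)) = qfact q n"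
proof -
  have "nat (int n - int m) = n - m" using assms(2) by simp
  moreover have "is_unit (qfact q m * qfact q (n - m))"
    using assms by (simp add: qfact_nth_0 fps_is_unit_iff)
  ultimately show ?thesis
    using assms(2) unfolding qbinom_def
    by (simp add: unit_imp_dvd)
qed

lemma qbinom_eq_0: "n < m \<Longrightarrow> qbinom q n m = 0"
  by (simp add: qbinom_def)

lemma qfact_neq_0: "fps_nth q 0 = 0 \<Longrightarrow> qfact q n \<noteq> 0"
  using qfact_nth_0[of q n] by force

lemma qbinom_self: "fps_nth q 0 = 0 \<Longrightarrow> qbinom q (int n) (int n) = 1"
  using qbinom_mult_qfact[of q n n] qfact_neq_0[of q n] by (simp add: qpoch_def)

lemma qbinom_0: "fps_nth q 0 = 0 \<Longrightarrow> qbinom q (int n) 0 = 1"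
  using qbinom_mult_qfact[of q 0 n] qfact_neq_0[of q n] by (simp add: qpoch_def)

lemma qbinom_pascal_right:
  assumes q: "fps_nth q 0 = 0" and "m \<le> n"
  shows "qbinom q (int (Suc n)) (int (Suc m))
    = qbinom q (int n) (int (Suc m)) + q ^ (n - m) * qbinom q (int n) (int m)"
proof (cases "m = n")
  case True
  then show ?thesis by (simp only: qbinom_self[OF q]) (simp add: qbinom_eq_0)
next
  case False
  then obtain d where n: "n = m + Suc d" using assms(2) by (metis add_Suc_right le_neq_implies_less less_imp_Suc_add)
  let ?D = "qfact q (Suc m) * qfact q (Suc d)"
  have b1: "qbinom q (int (Suc n)) (int (Suc m)) * ?D = qfact q (Suc n)"
    using qbinom_mult_qfact[OF q, of "Suc m" "Suc n"] n by simp
  have b2: "qbinom q (int n) (int (Suc m)) * (qfact q (Suc m) * qfact q d) = qfact q n"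
    using qbinom_mult_qfact[OF q, of "Suc m" n] n by simp
  have b3: "qbinom q (int n) (int m) * (qfact q m * qfact q (Suc d)) = qfact q n"
    using qbinom_mult_qfact[OF q, of m n] n by simp
  have "(qbinom q (int n) (int (Suc m)) + q ^ (n - m) * qbinom q (int n) (int m)) * ?D
    = (1 - q ^ Suc d) * (qbinom q (int n) (int (Suc m)) * (qfact q (Suc m) * qfact q d))
      + q ^ Suc d * (1 - q ^ Suc m) * (qbinom q (int n) (int m) * (qfact q m * qfact q (Suc d)))"
    by (simp add: n qpoch_Suc algebra_simps)
  also have "\<dots> = ((1 - q ^ Suc d) + q ^ Suc d * (1 - q ^ Suc m)) * qfact q n"
    unfolding b2 b3 by (simp add: algebra_simps)
  also have "\<dots> = qfact q (Suc n)"
    by (simp add: n qpoch_Suc algebra_simps power_add)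
  finally have "(qbinom q (int n) (int (Suc m)) + q ^ (n - m) * qbinom q (int n) (int m)) * ?D
      = qbinom q (int (Suc n)) (int (Suc m)) * ?D"
    using b1 by simp
  then show ?thesis using qfact_neq_0[OF q] by simp
qed

lemma qbinom_pascal_left:
  assumes q: "fps_nth q 0 = 0"
  shows "qbinom q (int (Suc n)) (int (Suc m))
    = q ^ Suc m * qbinom q (int n) (int (Suc m)) + qbinom q (int n) (int m)"
proof (cases "m < n")
  case False
  then show ?thesis
    by (cases "m = n") (simp_all only: qbinom_self[OF q], simp_all add: qbinom_eq_0)
next
  case True
  then obtain d where n: "n = m + Suc d" by (metis add_Suc_right less_imp_Suc_add)
  let ?D = "qfact q (Suc m) * qfact q (Suc d)"
  have b1: "qbinom q (int (Suc n)) (int (Suc m)) * ?D = qfact q (Suc n)"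
    using qbinom_mult_qfact[OF q, of "Suc m" "Suc n"] n by simp
  have b2: "qbinom q (int n) (int (Suc m)) * (qfact q (Suc m) * qfact q d) = qfact q n"
    using qbinom_mult_qfact[OF q, of "Suc m" n] n by simp
  have b3: "qbinom q (int n) (int m) * (qfact q m * qfact q (Suc d)) = qfact q n"
    using qbinom_mult_qfact[OF q, of m n] n by simp
  have "(q ^ Suc m * qbinom q (int n) (int (Suc m)) + qbinom q (int n) (int m)) * ?D
    = q ^ Suc m * (1 - q ^ Suc d) * (qbinom q (int n) (int (Suc m)) * (qfact q (Suc m) * qfact q d))
      + (1 - q ^ Suc m) * (qbinom q (int n) (int m) * (qfact q m * qfact q (Suc d)))"
    by (simp add: qpoch_Suc algebra_simps)
  also have "\<dots> = (q ^ Suc m * (1 - q ^ Suc d) + (1 - q ^ Suc m)) * qfact q n"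
    unfolding b2 b3 by (simp add: algebra_simps)
  also have "\<dots> = qfact q (Suc n)"
    by (simp add: n qpoch_Suc algebra_simps power_add)
  finally have "(q ^ Suc m * qbinom q (int n) (int (Suc m)) + qbinom q (int n) (int m)) * ?D
      = qbinom q (int (Suc n)) (int (Suc m)) * ?D"
    using b1 by simp
  then show ?thesis using qfact_neq_0[OF q] by simp
qed

section \<open>The double sum\<close>

definition summand :: "nat \<Rightarrow> nat \<Rightarrow> nat \<Rightarrow> rat fps" where
  "summand M j k = fps_X ^ (j^2 + k^2 + j) * qbinom (fps_X ^ 2) (int M - int k) (int j)
     * qbinom (fps_X ^ 2) (int j) (int k)"

lemma X2_nth_0: "fps_nth ((fps_X :: rat fps) ^ 2) 0 = 0"
  by (simp add: power2_eq_square)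

lemma summand_eq_0: "M < j + k \<or> j < k \<Longrightarrow> summand M j k = 0"
  by (auto simp: summand_def qbinom_eq_0)

lemma summand_0: "summand M 0 k = of_bool (k = 0)"
  using qbinom_0[OF X2_nth_0, of M] qbinom_0[OF X2_nth_0, of 0]
  by (cases k) (simp_all add: summand_def qbinom_eq_0)

text \<open>The rule \<open>[N + 1, j + 1] = [N, j + 1] + Q\<^bsup>N - j\<^esup> [N, j]\<close> for the first factor, where \<open>Q = q\<^sup>2\<close> and
  \<open>N = M + 1 - k\<close>, splits off the first term. In the rest, the second factor is still \<open>[j + 1, k]\<close>; the rule
  \<open>[j + 1, k] = Q\<^sup>k [j, k] + [j, k - 1]\<close> gives the other two terms, and the powers of \<open>q\<close> combine to
  factors that do not depend on \<open>j\<close> and \<open>k\<close>.\<close>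

lemma summand_rec:
  "summand (Suc (Suc M)) (Suc j) k = summand (Suc M) (Suc j) k
     + fps_X ^ (2 * M + 4) * summand (Suc M) j k
     + (case k of 0 \<Rightarrow> 0 | Suc k' \<Rightarrow> fps_X ^ (2 * M + 3) * summand M j k')"
proof (cases "j + k \<le> Suc M \<and> k \<le> Suc j")
  case False
  \<comment> \<open>All terms vanish; outside this case the subtractions below are exact.\<close>
  then have "M < j + (k - 1) \<or> j < k - 1 \<or> k = 0" "Suc M < j + k \<or> j < k"
    "Suc (Suc M) < Suc j + k \<or> Suc j < k"
    by linarith+
  then show ?thesis by (cases k) (auto simp: summand_eq_0)
next
  case True
  define N where "N = Suc M - k"
  define Q where "Q = (fps_X :: rat fps) ^ 2"
  have Q0: "fps_nth Q 0 = 0" unfolding Q_def by (rule X2_nth_0)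
  have jN: "j \<le> N" "k \<le> Suc M" using True by (auto simp: N_def)
  have up: "int (Suc (Suc M)) - int k = int (Suc N)" "int (Suc M) - int k = int N"
    using jN by (simp_all add: N_def)
  have *: "summand (Suc (Suc M)) (Suc j) k = summand (Suc M) (Suc j) k
     + fps_X ^ ((Suc j)^2 + k^2 + Suc j) * Q ^ (N - j) * qbinom Q (int N) (int j) 
         * qbinom Q (int (Suc j)) (int k)"
    unfolding summand_def up Q_def[symmetric] qbinom_pascal_right[OF Q0 jN(1)]
    by (simp only: distrib_left distrib_right mult.assoc)
  have ex: "fps_X ^ ((Suc j)^2 + k^2 + Suc j) * Q ^ (N - j) 
      = (fps_X :: rat fps) ^ ((Suc j)^2 + k^2 + Suc j + 2 * (N - j))"
    by (simp add: Q_def power_add power_mult)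
  have "fps_X ^ ((Suc j)^2 + k^2 + Suc j) * Q ^ (N - j) * qbinom Q (int N) (int j) 
         * qbinom Q (int (Suc j)) (int k)
     = fps_X ^ (2 * M + 4) * summand (Suc M) j k
     + (case k of 0 \<Rightarrow> 0 | Suc k' \<Rightarrow> fps_X ^ (2 * M + 3) * summand M j k')"
  proof (cases k)
    case 0
    have e: "(Suc j)^2 + k^2 + Suc j + 2 * (N - j) = (2 * M + 4) + (j^2 + k^2 + j)"
      using jN 0 by (simp add: N_def power2_eq_square)
    show ?thesis
      unfolding ex e summand_def up Q_def[symmetric] unfolding 0 
      using qbinom_0[OF Q0, of j] qbinom_0[OF Q0, of "Suc j"] by (simp add: power_add mult.assoc)
  next
    case (Suc k')
    have N: "N = M - k'" "k' \<le> M" using Suc jN by (auto simp: N_def)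
    have e: "(Suc j)^2 + k^2 + Suc j + 2 * (N - j) = (2 * M + 3) + (j^2 + k'^2 + j)"
      using jN N by (simp add: Suc power2_eq_square)
    have e': "(2 * M + 3) + (j^2 + k'^2 + j) + 2 * k = (2 * M + 4) + (j^2 + k^2 + j)"
      by (simp add: Suc power2_eq_square)
    have e'': "fps_X ^ ((2 * M + 3) + (j^2 + k'^2 + j)) * Q ^ k 
        = (fps_X :: rat fps) ^ (2 * M + 4) * fps_X ^ (j^2 + k^2 + j)"
      unfolding power_add[symmetric] e'[symmetric] by (simp add: Q_def power_add power_mult)
    have up': "int M - int k' = int N" using N by simp
    have "fps_X ^ ((2 * M + 3) + (j^2 + k'^2 + j)) * qbinom Q (int N) (int j) * qbinom Q (int (Suc j)) (int k)
      = (fps_X ^ ((2 * M + 3) + (j^2 + k'^2 + j)) * Q ^ k) * qbinom Q (int N) (int j) * qbinom Q (int j) (int k)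
       + fps_X ^ (2 * M + 3) * (fps_X ^ (j^2 + k'^2 + j) * qbinom Q (int N) (int j) * qbinom Q (int j) (int k'))"
      unfolding Suc qbinom_pascal_left[OF Q0] 
      by (simp only: distrib_left distrib_right mult_ac power_add)
    then show ?thesis
      unfolding ex e summand_def up up' Q_def[symmetric] e'' 
      by (simp only: Suc nat.case up' mult.assoc)
  qed
  then show ?thesis unfolding * by simp
qed

text \<open>The ranges may be enlarged at will, which absorbs the index shifts in the recurrence.\<close>

lemma sum_summand_eq:
  assumes "M \<le> B" "M \<le> C"
  shows "(\<Sum>j\<le>B. \<Sum>k\<le>C. summand M j k) = (\<Sum>j\<le>M. \<Sum>k\<le>M. summand M j k)"
proof -
  have "(\<Sum>j\<le>B. \<Sum>k\<le>C. summand M j k) = (\<Sum>j\<le>B. \<Sum>k\<le>M. summand M j k)"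
    using assms by (intro sum.cong refl sum.mono_neutral_right) (auto simp: summand_eq_0)
  also have "\<dots> = (\<Sum>j\<le>M. \<Sum>k\<le>M. summand M j k)"
    using assms by (intro sum.mono_neutral_right) (auto simp: summand_eq_0)
  finally show ?thesis .
qed

lemma sum_summand_rec:
  defines "S \<equiv> \<lambda>M. \<Sum>j\<le>M. \<Sum>k\<le>M. summand M j k"
  shows "S (Suc (Suc M)) = (1 + fps_X ^ (2 * M + 4)) * S (Suc M) + fps_X ^ (2 * M + 3) * S M"
proof -
  let ?K = "{..Suc (Suc M)}"
  have "S (Suc (Suc M)) = (\<Sum>k\<in>?K. summand (Suc (Suc M)) 0 k)
      + (\<Sum>j\<le>Suc M. \<Sum>k\<in>?K. summand (Suc (Suc M)) (Suc j) k)"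
    unfolding S_def by (rule sum.atMost_Suc_shift)
  also have "(\<Sum>k\<in>?K. summand (Suc (Suc M)) 0 k) = (\<Sum>k\<in>?K. summand (Suc M) 0 k)"
    by (simp only: summand_0)
  also have "(\<Sum>j\<le>Suc M. \<Sum>k\<in>?K. summand (Suc (Suc M)) (Suc j) k)
     = (\<Sum>j\<le>Suc M. \<Sum>k\<in>?K. summand (Suc M) (Suc j) k)
     + fps_X ^ (2 * M + 4) * (\<Sum>j\<le>Suc M. \<Sum>k\<in>?K. summand (Suc M) j k)
     + (\<Sum>j\<le>Suc M. \<Sum>k\<in>?K. (case k of 0 \<Rightarrow> 0 | Suc k' \<Rightarrow> fps_X ^ (2 * M + 3) * summand M j k'))"
    unfolding summand_rec sum.distrib sum_distrib_left ..
  also have "(\<Sum>j\<le>Suc M. \<Sum>k\<in>?K. (case k of 0 \<Rightarrow> 0 | Suc k' \<Rightarrow> fps_X ^ (2 * M + 3) * summand M j k'))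
     = fps_X ^ (2 * M + 3) * (\<Sum>j\<le>Suc M. \<Sum>k\<le>Suc M. summand M j k)"
    unfolding sum.atMost_Suc_shift[of _ "Suc M"] sum_distrib_left by simp
  also have "(\<Sum>j\<le>Suc M. \<Sum>k\<le>Suc M. summand M j k) = S M"
    unfolding S_def by (rule sum_summand_eq) auto
  also have "(\<Sum>j\<le>Suc M. \<Sum>k\<in>?K. summand (Suc M) j k) = S (Suc M)"
    unfolding S_def by (rule sum_summand_eq) auto
  also have "(\<Sum>k\<in>?K. summand (Suc M) 0 k) + ((\<Sum>j\<le>Suc M. \<Sum>k\<in>?K. summand (Suc M) (Suc j) k)
       + fps_X ^ (2 * M + 4) * S (Suc M) + fps_X ^ (2 * M + 3) * S M)
     = (\<Sum>j\<le>Suc (Suc M). \<Sum>k\<in>?K. summand (Suc M) j k)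
       + fps_X ^ (2 * M + 4) * S (Suc M) + fps_X ^ (2 * M + 3) * S M"
    by (simp only: sum.atMost_Suc_shift[of _ "Suc M"] add.assoc)
  also have "(\<Sum>j\<le>Suc (Suc M). \<Sum>k\<in>?K. summand (Suc M) j k) = S (Suc M)"
    unfolding S_def by (rule sum_summand_eq) auto
  finally show ?thesis by (simp add: distrib_right add.assoc)
qed

lemma sum_summand_eq_ladder_poly:
  "(\<Sum>j\<le>M. \<Sum>k\<le>M. summand M j k) = fps_of_poly (ladder_poly M)"
proof (induction M rule: ladder_poly.induct)
  case 1
  show ?case by (simp add: summand_0)
next
  case 2
  have "summand (Suc 0) (Suc 0) 0 = fps_X ^ 2"
    using qbinom_self[OF X2_nth_0, of "Suc 0"] qbinom_0[OF X2_nth_0, of "Suc 0"]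
    by (simp add: summand_def power2_eq_square)
  then show ?case
    by (simp add: summand_0 summand_eq_0 fps_of_poly_add fps_of_poly_monom')
next
  case (3 M)
  then show ?case
    by (simp only: sum_summand_rec ladder_poly.simps fps_of_poly_add fps_of_poly_mult fps_of_poly_monom' fps_of_poly_1)
qed

lemma has_sum_summand:
  "((\<lambda>(j, k). summand M j k) has_sum fps_of_poly (ladder_poly M)) UNIV"
proof -
  have "((\<lambda>(j, k). summand M j k) has_sum (\<Sum>(j, k)\<in>{..M} \<times> {..M}. summand M j k)) ({..M} \<times> {..M})"
    by (rule has_sum_finite) simp
  then show ?thesis
    unfolding sum.cartesian_product[symmetric] sum_summand_eq_ladder_poly
    by (rule has_sum_cong_neutral[THEN iffD1, rotated 3])
       (auto intro!: summand_eq_0)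
qed


section \<open>Double shifted plane partitions as labellings of a ladder\<close>

lemma numerator_ladder_eq: "numerator above (ladder M) = fps_of_poly (ladder_poly M)"
proof (induction M rule: ladder_poly.induct)
  case 1
  show ?case by (simp add: numerator_ladder_0)
next
  case 2
  show ?case
    by (simp only: numerator_ladder_1 ladder_poly.simps fps_of_poly_add fps_of_poly_monom' fps_of_poly_1)
next
  case (3 M)
  then show ?case
    by (simp only: numerator_ladder_rec ladder_poly.simps fps_of_poly_add fps_of_poly_mult
        fps_of_poly_monom' fps_of_poly_1)
qed

text \<open>With entries indexed from \<open>0\<close>, \<open>b\<close> and
  \<open>c\<close> alternate along the chain \<open>Y\<close>, starting with \<open>b\<close>, and \<open>a\<close> and \<open>d\<close> alternate along \<open>X 1, X 2, \<dots>\<close>.\<close>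

definition rows :: "(node \<Rightarrow> nat) \<Rightarrow> partition4" where
  "rows f = (\<lambda>i. f (X (2 * i + 1)), \<lambda>i. f (Y (2 * i)), \<lambda>i. f (Y (2 * i + 1)), \<lambda>i. f (X (2 * i + 2)))"

lemma labellings_ladder_zero:
  assumes "f \<in> labellings above (ladder M)"
  shows "f (X 0) = 0" "Suc M < i \<Longrightarrow> f (Y i) = 0" "M < i \<Longrightarrow> f (X i) = 0"
proof -
  have "X 0 \<notin> ladder M" "Suc M < i \<Longrightarrow> Y i \<notin> ladder M" "M < i \<Longrightarrow> X i \<notin> ladder M"
    by (auto simp: ladder_def)
  then show "f (X 0) = 0" "Suc M < i \<Longrightarrow> f (Y i) = 0" "M < i \<Longrightarrow> f (X i) = 0"
    using assms by (auto simp: labellings_def)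
qed

text \<open>A ladder is closed upwards except at \<open>X 0\<close>, so the inequalities hold for all nodes, not only for
  those of the ladder: below it the labels are \<open>0\<close>.\<close>

lemma labellings_ladder_above:
  assumes "f \<in> labellings above (ladder M)" "above u v" "u \<noteq> X 0"
  shows "f v \<le> f u"
proof (cases "v \<in> ladder M")
  case True
  with assms(2,3) have "u \<in> ladder M"
    by (cases u; cases v) (auto simp: ladder_def)
  with assms True show ?thesis by (simp add: labellings_def)
next
  case False
  with assms(1) show ?thesis by (simp add: labellings_def)
qed

lemma rows_labellings:
  assumes f: "f \<in> labellings above (ladder (2 * m + 1))"
  shows "rows f \<in> DSPP100'' (Suc m)"
proof -
  note zero = labellings_ladder_zero[OF f]
  note le = labellings_ladder_above[OF f]
  have part: "is_partition p" if "\<And>i. p (Suc i) \<le> p i" "\<And>i. m + 1 < i \<Longrightarrow> p i = 0" for p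
  proof -
    have "{i. p i \<noteq> 0} \<subseteq> {..m + 1}" using that(2) by (auto simp: not_less[symmetric])
    then show ?thesis
      unfolding is_partition_def using that(1)
      by (auto simp: decseq_Suc_iff intro: finite_subset)
  qed
  show ?thesis
    unfolding rows_def DSPP100''_def DSPP100_def interlaces_def
    by (auto intro!: part le zero)
qed

lemma inj_on_rows: "inj_on rows (labellings above (ladder M))"
proof (rule inj_onI)
  fix f g assume f: "f \<in> labellings above (ladder M)" and g: "g \<in> labellings above (ladder M)"
    and eq: "rows f = rows g"
  have 0: "f (X 0) = g (X 0)"
    using f g by (simp add: labellings_ladder_zero)
  show "f = g"
  proof
    fix u show "f u = g u"
    proof (cases u)
      case (X i)
      consider "i = 0" | m where "i = 2 * m + 1" | m where "i = 2 * m + 2"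
        by (metis add_2_eq_Suc' dvd_def even_Suc not0_implies_Suc oddE Suc_eq_plus1 mult_Suc_right add.commute)
      then show ?thesis
        using eq X 0 by cases (auto simp: rows_def fun_eq_iff)
    next
      case (Y i)
      consider m where "i = 2 * m" | m where "i = 2 * m + 1"
        by (metis evenE oddE)
      then show ?thesis
        using eq Y by cases (auto simp: rows_def fun_eq_iff)
    qed
  qed
qed

text \<open>The interlacing conditions only compare neighbouring nodes. Every relation of the ladder follows
  from them through the chain \<open>Y\<close>; for instance \<open>X i\<close> lies above \<open>X j\<close> for \<open>i + 1 < j\<close> because
  \<open>Y (i + 1)\<close> lies between them.\<close>

lemma rows_surj:
  assumes "\<Lambda> \<in> DSPP100'' (Suc m)"
  shows "\<Lambda> \<in> rows ` labellings above (ladder (2 * m + 1))"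
proof -
  obtain a b c d where \<Lambda>: "\<Lambda> = (a, b, c, d)" by (cases \<Lambda>)
  have anti: "antimono a" "antimono b" "antimono c" "antimono d"
    and int: "\<And>i. a i \<le> b i" "\<And>i. b (Suc i) \<le> a i" "\<And>i. c i \<le> b i" "\<And>i. b (Suc i) \<le> c i"
      "\<And>i. d i \<le> c i" "\<And>i. c (Suc i) \<le> d i"
    and zero: "a (Suc m) = 0" "b (m + 2) = 0" "c (Suc m) = 0" "d m = 0"
    using assms unfolding \<Lambda> DSPP100''_def DSPP100_def is_partition_def interlaces_def by auto
  define x where "x i = (if i = 0 then 0 else if odd i then a (i div 2) else d (i div 2 - 1))" for i
  define y where "y i = (if even i then b (i div 2) else c (i div 2))" for i
  define f where "f = case_node x y"
  have xy: "x (2 * i + 1) = a i" "x (2 * i + 2) = d i" "y (2 * i) = b i" "y (2 * i + 1) = c i" for i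
    by (simp_all add: x_def y_def)
  have yy: "y (Suc i) \<le> y i" for i
    using int by (cases "even i") (auto simp: y_def)
  have xy': "x (Suc i) \<le> y i" for i
    using int by (cases "even i") (auto simp: x_def y_def)
  have yx: "y (Suc i) \<le> x i" if "0 < i" for i
  proof (cases "even i")
    case True
    with that have "c (i div 2) \<le> d (i div 2 - 1)"
      using int(6)[of "i div 2 - 1"] by (auto elim!: evenE)
    with that True show ?thesis by (simp add: x_def y_def)
  next
    case False
    then have "i \<noteq> 0" by (rule contrapos_nn) simp
    with False int show ?thesis by (simp add: x_def y_def)
  qed
  have anti_y: "y j \<le> y i" if "i \<le> j" for i j
    using that yy by (rule lift_Suc_antimono_le[rotated])
  have xy'': "x j \<le> y i" if "i < j" for i j
    using that xy'[of "j - 1"] anti_y[of i "j - 1"] by (cases j) auto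
  have yx': "y j \<le> x i" if "i < j" "0 < i" for i j
    using that yx[of i] anti_y[of "Suc i" j] by simp
  have xx: "x j \<le> x i" if "Suc i < j" "0 < i" for i j
    using that xy''[of "Suc i" j] yx[of i] by simp
  have y0: "y i = 0" if "2 * m + 2 < i" for i
    using that anti_y[of "2 * Suc m + 1" i] zero(3) unfolding xy by simp
  have x0: "x i = 0" if "2 * m + 1 < i" for i
  proof (cases "even i")
    case True
    then have "d (i div 2 - 1) \<le> d m" using that by (intro antimonoD[OF anti(4)]) auto
    with True zero show ?thesis by (simp add: x_def)
  next
    case False
    then have "a (i div 2) \<le> a (Suc m)" using that by (intro antimonoD[OF anti(1)]) auto
    with False zero show ?thesis by (simp add: x_def)
  qed
  have "f \<in> labellings above (ladder (2 * m + 1))"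
    unfolding labellings_def
  proof (intro CollectI conjI allI impI ballI)
    fix u assume "u \<notin> ladder (2 * m + 1)"
    then show "f u = 0"
      using x0 y0 by (cases u) (auto simp: f_def ladder_def image_iff x_def[of 0] not_le)
  next
    fix u v assume "u \<in> ladder (2 * m + 1)" "v \<in> ladder (2 * m + 1)" "above u v"
    then show "f v \<le> f u"
      by (cases u; cases v) (auto simp: f_def ladder_def intro: anti_y xy'' yx' xx)
  qed
  moreover have "\<Lambda> = rows f"
    unfolding \<Lambda> rows_def f_def by (simp only: node.case xy)
  ultimately show ?thesis by (simp only: image_eqI)
qed

lemma partition_size_eq:
  assumes "\<And>i. k \<le> i \<Longrightarrow> p i = 0"
  shows "partition_size p = sum p {..<k}"
proof -
  have "i < k" if "p i \<noteq> 0" for i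
    using assms[of i] that by (cases "k \<le> i") auto
  then show ?thesis
    unfolding partition_size_def by (intro sum.mono_neutral_left) auto
qed

lemma sum_parity_split:
  fixes g :: "nat \<Rightarrow> nat"
  shows "(\<Sum>i\<le>2 * n. g i) = (\<Sum>i<Suc n. g (2 * i)) + (\<Sum>i<n. g (2 * i + 1))"
    and "(\<Sum>i=1..2 * n + 1. g i) = (\<Sum>i<Suc n. g (2 * i + 1)) + (\<Sum>i<n. g (2 * i + 2))"
  by (induction n) simp_all

lemma DSPP_size_rows:
  assumes f: "f \<in> labellings above (ladder (2 * m + 1))"
  shows "DSPP_size (rows f) = sum f (ladder (2 * m + 1))"
proof -
  note zero = labellings_ladder_zero[OF f]
  have "sum f (ladder (2 * m + 1)) = sum f (Y ` {..2 * Suc m}) + sum f (X ` {1..2 * m + 1})"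
    unfolding ladder_def by (subst sum.union_disjoint) auto
  also have "\<dots> = (\<Sum>i\<le>2 * Suc m. f (Y i)) + (\<Sum>i=1..2 * m + 1. f (X i))"
    by (simp only: sum.reindex inj_on_def node.inject comp_def simp_thms Ball_def)
  also have "\<dots> = DSPP_size (rows f)"
    unfolding sum_parity_split rows_def DSPP_size.simps
    by (subst (1 2 3 4) partition_size_eq[where k = "Suc m"]
          partition_size_eq[where k = "Suc (Suc m)"]
          partition_size_eq[where k = "Suc m"] partition_size_eq[where k = m])
       (simp_all add: zero)
  finally show ?thesis ..
qed

lemma P100''_eq_numerator: "P100'' (Suc m) = numerator above (ladder (2 * m + 1))"
proof -
  let ?V = "ladder (2 * m + 1)"
  have "card {\<Lambda> \<in> DSPP100'' (Suc m). DSPP_size \<Lambda> = k}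
      = card {f \<in> labellings above ?V. sum f ?V = k}" for k
  proof -
    have "{\<Lambda> \<in> DSPP100'' (Suc m). DSPP_size \<Lambda> = k}
        = rows ` {f \<in> labellings above ?V. sum f ?V = k}"
    proof -
      have "DSPP100'' (Suc m) = rows ` labellings above ?V"
        using rows_labellings rows_surj by blast
      then show ?thesis
        by (auto simp: DSPP_size_rows simp del: DSPP_size.simps)
    qed
    moreover have "inj_on rows {f \<in> labellings above ?V. sum f ?V = k}"
      by (rule inj_on_subset[OF inj_on_rows]) auto
    ultimately show ?thesis by (simp add: card_image)
  qed
  moreover have "card ?V = 4 * Suc m"
    unfolding ladder_def by (subst card_nodes) auto
  ultimately show ?thesis
    by (simp add: P100''_def F100''_def numerator_def sum_gf_def)
qed

theorem theorem7p5:
  fixes n :: nat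
  assumes "n \<ge> 1"
  shows "((\<lambda>(j::nat, k::nat). fps_X ^ (j^2 + k^2 + j)
             * qbinom (fps_X ^ 2) (2 * int n - int k - 1) (int j)
             * qbinom (fps_X ^ 2) (int j) (int k)) has_sum P100'' n) UNIV
         \<and> (\<exists>p :: rat poly. P100'' n = fps_of_poly p \<and> palindromic p)"
proof -
  obtain m where n: "n = Suc m"
    using assms by (cases n) auto
  have P: "P100'' n = fps_of_poly (ladder_poly (2 * m + 1))"
    unfolding n P100''_eq_numerator numerator_ladder_eq ..
  have "2 * int n - int k - 1 = int (2 * m + 1) - int k" for k
    by (simp add: n)
  then have "((\<lambda>(j::nat, k::nat). fps_X ^ (j^2 + k^2 + j)
             * qbinom (fps_X ^ 2) (2 * int n - int k - 1) (int j)
             * qbinom (fps_X ^ 2) (int j) (int k)) has_sum P100'' n) UNIV"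
    using has_sum_summand[of "2 * m + 1"] unfolding P summand_def by (simp only:)
  with palindromic_ladder_poly P show ?thesis by blast
qed

end
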